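(* Let $D$ be a directed tree. Then there is an isomorphism of posets $\mathcal{O}(\mathsf{B}(D^{\mathrm{op}})) \simeq \mathcal{O}(\mathsf{B}(D))^{\mathrm{op}}$.
   Context: A directed tree is a directed graph $D=(V,E)$ whose underlying undirected graph is a tree. $D^{\mathrm{op}}$ is the directed graph on the same vertex set with all edge orientations reversed. For a poset $P$, $P^{\mathrm{op}}$ is its dual poset (reversed order). A pointed subset $(S,v)$ of $V$ is a pair with $S\subseteq V$ and $v\in S$; it is often identified with its underlying set $S$. For a directed graph $D=(V,E)$ and $v\in V$, a subset $S\subseteq V$ with $v\in S$ is $v$-connected if for every $u\in S$ there is a directed path from $v$ to $u$ with all vertices in $S$ (a path may consist of a single vertex). The digraphical pointed building set of $D$ is $\mathsf{B}(D):=\{(S,v)\mid S \text{ is } v\text{-connected in } D\}$. An ornamentation of $\mathsf{B}(D)$ is a function $\rho:V\to\mathsf{B}(D)$ such that $\rho(v)$ is pointed at $v$ for all $v\in V$, and whenever $u\in\rho(v)$ then $\rho(u)\subseteq\rho(v)$. $\mathcal{O}(\mathsf{B}(D))$ is the set of ornamentations, partially ordered by $\rho_1\preceq\rho_2$ iff $\rho_1(v)\subseteq\rho_2(v)$ for all $v\in V$. *)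

theory Defs
  imports "Graph_Theory.Graph_Theory" "HOL-Algebra.Order" "HOL-Library.FuncSet"
begin

text \<open>
  A directed tree is an orientation of a tree: each edge of the underlying graph carries exactly one
  direction, which is what \<^term>\<open>asym (parcs D)\<close> says (a pair of opposite arcs would be a double
  edge of the underlying graph, i.e. a cycle). In \<^const>\<open>mk_symmetric\<close> every undirected edge is
  represented by both of its directions, so walking along an edge and back is a
  \<^const>\<open>pre_digraph.cycle\<close> of length 2; the cycles of the underlying undirected graph are those of
  length at least 3. The predicate \<^const>\<open>tree\<close> is not used because it only forbids directed
  cycles. Infinite trees are allowed.
\<close>

definition directed_tree :: "'a pair_pre_digraph \<Rightarrow> bool" where
  "directed_tree D \<longleftrightarrow>
     pair_wf_digraph D \<and> asym (parcs D) \<and>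
     Digraph_Component.connected (with_proj D) \<and>
     \<not> (\<exists>p. pre_digraph.cycle (with_proj (mk_symmetric (with_proj D))) p \<and> 3 \<le> length p)"

definition op_digraph :: "'a pair_pre_digraph \<Rightarrow> 'a pair_pre_digraph" where
  "op_digraph D = \<lparr>pverts = pverts D, parcs = (parcs D)\<inverse>\<rparr>"

definition v_connected :: "'a pair_pre_digraph \<Rightarrow> 'a \<Rightarrow> 'a set \<Rightarrow> bool" where
  "v_connected D v S \<longleftrightarrow>
     S \<subseteq> pverts D \<and> v \<in> S \<and>
     (\<forall>u\<in>S. \<exists>p. vpath p (with_proj D) \<and> hd p = v \<and> last p = u \<and> set p \<subseteq> S)"

definition building_set :: "'a pair_pre_digraph \<Rightarrow> ('a set \<times> 'a) set" where
  "building_set D = {(S, v). v_connected D v S}"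

text \<open>
  Functions on \<open>V\<close> are represented by extensional functions, so that two ornamentations are equal
  as soon as they agree on \<open>V\<close>.
\<close>

definition ornamentations :: "'a set \<Rightarrow> ('a set \<times> 'a) set \<Rightarrow> ('a \<Rightarrow> 'a set \<times> 'a) set" where
  "ornamentations V B =
     {\<rho> \<in> V \<rightarrow>\<^sub>E B. (\<forall>v\<in>V. snd (\<rho> v) = v) \<and>
                  (\<forall>v\<in>V. \<forall>u\<in>fst (\<rho> v). fst (\<rho> u) \<subseteq> fst (\<rho> v))}"

definition ornamentation_poset :: "'a set \<Rightarrow> ('a set \<times> 'a) set \<Rightarrow> ('a \<Rightarrow> 'a set \<times> 'a) gorder" where
  "ornamentation_poset V B =
     \<lparr>carrier = ornamentations V B, eq = (=),
      le = (\<lambda>\<rho>\<^sub>1 \<rho>\<^sub>2. \<forall>v\<in>V. fst (\<rho>\<^sub>1 v) \<subseteq> fst (\<rho>\<^sub>2 v))\<rparr>"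

lemma partial_order_ornamentation_poset: "partial_order (ornamentation_poset V B)"
proof
  fix \<rho>\<^sub>1 \<rho>\<^sub>2
  assume le: "\<rho>\<^sub>1 \<sqsubseteq>\<^bsub>ornamentation_poset V B\<^esub> \<rho>\<^sub>2" "\<rho>\<^sub>2 \<sqsubseteq>\<^bsub>ornamentation_poset V B\<^esub> \<rho>\<^sub>1"
    and "\<rho>\<^sub>1 \<in> carrier (ornamentation_poset V B)" "\<rho>\<^sub>2 \<in> carrier (ornamentation_poset V B)"
  then have mem: "\<rho>\<^sub>1 \<in> ornamentations V B" "\<rho>\<^sub>2 \<in> ornamentations V B"
    by (simp_all add: ornamentation_poset_def)
  have "\<rho>\<^sub>1 = \<rho>\<^sub>2"
  proof (rule PiE_ext)
    show "\<rho>\<^sub>1 \<in> V \<rightarrow>\<^sub>E B" "\<rho>\<^sub>2 \<in> V \<rightarrow>\<^sub>E B"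
      using mem by (simp_all add: ornamentations_def)
  next
    fix v assume "v \<in> V"
    then show "\<rho>\<^sub>1 v = \<rho>\<^sub>2 v"
      using le mem by (intro prod_eqI) (auto simp: ornamentation_poset_def ornamentations_def)
  qed
  then show "\<rho>\<^sub>1 .=\<^bsub>ornamentation_poset V B\<^esub> \<rho>\<^sub>2"
    by (simp add: ornamentation_poset_def)
qed (auto simp: ornamentation_poset_def)

definition digraph_ornamentation_poset ::
    "'a pair_pre_digraph \<Rightarrow> ('a \<Rightarrow> 'a set \<times> 'a) gorder" where
  "digraph_ornamentation_poset D = ornamentation_poset (pverts D) (building_set D)"

text \<open>\<^const>\<open>order_emb\<close> includes that both structures are partially ordered.\<close>

definition poset_iso :: "'a gorder \<Rightarrow> 'b gorder \<Rightarrow> ('a \<Rightarrow> 'b) \<Rightarrow> bool" where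
  "poset_iso A B f \<longleftrightarrow> bij_betw f (carrier A) (carrier B) \<and> order_emb A B f"

end

theory Submission
  imports Defs
begin

text \<open>
  The isomorphism is the correspondence between torsion classes and torsion-free classes.

  In a directed tree two directed walks with the same endpoints coincide. Reachability is therefore
  a partial order on the vertices in which every interval is a finite chain, and that chain is the
  only path between its endpoints. Consequently a set is \<open>v\<close>-connected iff it contains \<open>v\<close>, lies above
  \<open>v\<close> and contains with each \<open>u\<close> the whole interval \<open>[v, u]\<close>. Reading \<open>u \<in> \<rho>(v)\<close> as
  "\<open>[v, u]\<close> belongs to \<open>R\<close>" turns an ornamentation of \<open>D\<close> into a set \<open>R\<close> of intervals that contains
  all \<open>[v, v]\<close>, is closed under initial parts (connectedness), and is closed under concatenation
  (the nesting condition). Ornamentations of the opposite tree are the sets of intervals closed under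
  final parts and concatenation. The former are like torsion classes, with initial parts as quotients
  and final parts as subobjects, and the latter like torsion-free classes.

  To \<open>R\<close> is assigned the set of all intervals none of whose final parts, except for the one-point
  one, is in \<open>R\<close>. Bigger \<open>R\<close> have smaller images. The map is inverted by the same construction for the
  opposite order: if \<open>[x, u]\<close> is not in \<open>R\<close>, let \<open>[w, u]\<close> be its longest final part in \<open>R\<close>; by
  concatenation no final part of \<open>[x, w]\<close> other than \<open>[w, w]\<close> is in \<open>R\<close>, so \<open>[x, u]\<close> has an initial
  part with more than one point in the image of \<open>R\<close>. This is \<open>orth_orth\<close>; it and
  \<open>directed_walk_unique\<close> carry the proof.
\<close>

section \<open>Orders whose intervals are finite chains\<close>

locale chain_intervals =
  fixes V :: "'a set" and L :: "'a rel"
  assumes within: "L \<subseteq> V \<times> V"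
    and refl: "x \<in> V \<Longrightarrow> (x, x) \<in> L"
    and antisym: "antisym L"
    and trans: "trans L"
    and chain: "(v, w) \<in> L \<Longrightarrow> (w, u) \<in> L \<Longrightarrow> (v, w') \<in> L \<Longrightarrow> (w', u) \<in> L \<Longrightarrow>
                  (w, w') \<in> L \<or> (w', w) \<in> L"
    and finite_interval: "finite {w. (v, w) \<in> L \<and> (w, u) \<in> L}"

text \<open>
  The hypotheses are self-dual, so each fact about \<open>L\<close> is also available for \<open>L\<inverse>\<close>; the inverse of the
  orthogonality map comes from this.
\<close>

lemma (in chain_intervals) dual: "chain_intervals V (L\<inverse>)"
proof
  fix v u
  have "{w. (v, w) \<in> L\<inverse> \<and> (w, u) \<in> L\<inverse>} = {w. (u, w) \<in> L \<and> (w, v) \<in> L}"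
    by auto
  then show "finite {w. (v, w) \<in> L\<inverse> \<and> (w, u) \<in> L\<inverse>}"
    by (simp only: finite_interval)
qed (use within refl antisym trans chain in auto)

text \<open>
  A pair \<open>(v, u)\<close> stands for the interval \<open>[v, u]\<close>: the elements of this set are the torsion classes
  of the introduction when \<open>L\<close> is the order, and the torsion-free classes when \<open>L\<close> is its converse.
\<close>

definition ornament_rels :: "'a set \<Rightarrow> 'a rel \<Rightarrow> 'a rel set" where
  "ornament_rels V L =
     {R. R \<subseteq> L \<and> Id_on V \<subseteq> R \<and> trans R \<and>
         (\<forall>v w u. (v, u) \<in> R \<longrightarrow> (v, w) \<in> L \<longrightarrow> (w, u) \<in> L \<longrightarrow> (v, w) \<in> R)}"

text \<open>
  The pair is swapped because the result is a relation below \<open>L\<inverse>\<close>: \<open>(u, x)\<close> stands for the interval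
  that runs from \<open>x\<close> up to \<open>u\<close> in \<open>L\<close>.
\<close>

definition orth :: "'a rel \<Rightarrow> 'a rel \<Rightarrow> 'a rel" where
  "orth L R = {(u, x). (x, u) \<in> L \<and> (\<forall>w. (x, w) \<in> L \<and> (w, u) \<in> R \<longrightarrow> w = u)}"

lemma orth_antimono: "R \<subseteq> R' \<Longrightarrow> orth L R' \<subseteq> orth L R"
  by (auto simp: orth_def)

context chain_intervals
begin

text \<open>
  Concatenating \<open>[x, y]\<close> and \<open>[y, u]\<close>: because \<open>[x, u]\<close> is a chain, a final part of it lies inside
  \<open>[y, u]\<close> or contains \<open>y\<close>. In the second case its initial part ending in \<open>y\<close> is also in \<open>R\<close>, so
  one of the two pieces would already violate the condition.
\<close>

lemma orth_trans:
  assumes R: "R \<in> ornament_rels V L"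
  shows "trans (orth L R)"
proof (rule transI)
  fix u y x
  assume uy: "(u, y) \<in> orth L R" and yx: "(y, x) \<in> orth L R"
  then have L: "(y, u) \<in> L" "(x, y) \<in> L" by (auto simp: orth_def)
  have "w = u" if w: "(x, w) \<in> L" "(w, u) \<in> R" for w
  proof -
    have "(w, u) \<in> L" using w R by (auto simp: ornament_rels_def)
    with L w have "(y, w) \<in> L \<or> (w, y) \<in> L"
      using chain by blast
    then show "w = u"
    proof
      assume "(y, w) \<in> L"
      then show ?thesis using uy w by (auto simp: orth_def)
    next
      assume wy: "(w, y) \<in> L"
      \<comment> \<open>The initial part of \<open>[w, u]\<close> that ends in \<open>y\<close> is a final part of \<open>[x, y]\<close>.\<close>
      then have "(w, y) \<in> R" using R w L unfolding ornament_rels_def by blast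
      then have "w = y" using yx w by (auto simp: orth_def)
      then show ?thesis using uy w L within refl by (auto simp: orth_def)
    qed
  qed
  then show "(u, x) \<in> orth L R"
    using L trans by (auto simp: orth_def dest: transD)
qed

lemma orth_in_ornament_rels:
  assumes R: "R \<in> ornament_rels V L"
  shows "orth L R \<in> ornament_rels V (L\<inverse>)"
proof -
  have "Id_on V \<subseteq> orth L R"
    using R refl antisym by (auto simp: orth_def ornament_rels_def dest: antisymD)
  moreover have "(u, w) \<in> orth L R"
    if "(u, x) \<in> orth L R" "(u, w) \<in> L\<inverse>" "(w, x) \<in> L\<inverse>" for u w x
    using that trans by (auto simp: orth_def dest: transD)
  ultimately show ?thesis
    using orth_trans[OF R] unfolding ornament_rels_def by (auto simp: orth_def)
qed

text \<open>
  One inclusion holds because an initial part of a member of \<open>R\<close> is in \<open>R\<close> and is a final part of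
  itself, hence not orthogonal to \<open>R\<close> unless it is a point. The other inclusion uses the longest final
  part in \<open>R\<close>; its existence is where finiteness of the intervals enters.
\<close>

lemma orth_orth:
  assumes R: "R \<in> ornament_rels V L"
  shows "orth (L\<inverse>) (orth L R) = R"
proof (intro equalityI subrelI)
  fix x u
  assume xu: "(x, u) \<in> R"
  have "w = x" if w: "(w, u) \<in> L" "(w, x) \<in> orth L R" for w
  proof -
    have "(x, w) \<in> L" using w by (simp add: orth_def)
    with w xu R have "(x, w) \<in> R" unfolding ornament_rels_def by blast
    with w show ?thesis using \<open>(x, w) \<in> L\<close> within refl by (auto simp: orth_def)
  qed
  then show "(x, u) \<in> orth (L\<inverse>) (orth L R)"
    using xu R by (auto simp: orth_def[of "L\<inverse>"] ornament_rels_def)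
next
  fix x u
  assume xu: "(x, u) \<in> orth (L\<inverse>) (orth L R)"
  then have L: "(x, u) \<in> L" by (simp add: orth_def)
  define S where "S = {w. (x, w) \<in> L \<and> (w, u) \<in> R}"
  \<comment> \<open>The size of \<open>[x, w]\<close> measures how long the final part \<open>[w, u]\<close> is: the smaller, the longer.\<close>
  define below where "below w = {z. (x, z) \<in> L \<and> (z, w) \<in> L}" for w
  have "u \<in> S" using L R within by (auto simp: S_def ornament_rels_def)
  then obtain w where wS: "w \<in> S" and least: "\<And>z. z \<in> S \<Longrightarrow> card (below w) \<le> card (below z)"
    using ex_has_least_nat[of "\<lambda>w. w \<in> S" u "\<lambda>w. card (below w)"] by blast
  have wu: "(w, u) \<in> R" and xw: "(x, w) \<in> L" using wS by (auto simp: S_def)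
  have "z = w" if z: "(x, z) \<in> L" "(z, w) \<in> R" for z
  proof (rule ccontr)
    assume "z \<noteq> w"
    have zw: "(z, w) \<in> L" using z R by (auto simp: ornament_rels_def)
    have "(z, u) \<in> R" using z wu R by (auto simp: ornament_rels_def dest: transD)
    then have "z \<in> S" using z by (simp add: S_def)
    moreover have "below z \<subset> below w"
    proof (rule psubsetI)
      show "below z \<subseteq> below w" using zw trans by (auto simp: below_def dest: transD)
      have "w \<in> below w" using xw within refl by (auto simp: below_def)
      moreover have "w \<notin> below z"
        using zw \<open>z \<noteq> w\<close> antisym by (auto simp: below_def dest: antisymD)
      ultimately show "below z \<noteq> below w" by blast
    qed
    then have "card (below z) < card (below w)"
      by (rule psubset_card_mono[rotated]) (simp add: below_def finite_interval)
    ultimately show False using least[of z] by simp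
  qed
  then have "(w, x) \<in> orth L R" using xw by (auto simp: orth_def)
  moreover have "(w, u) \<in> L" using wu R by (auto simp: ornament_rels_def)
  ultimately have "w = x" using xu by (auto simp: orth_def[of "L\<inverse>"])
  then show "(x, u) \<in> R" using wu by simp
qed

lemma bij_betw_orth: "bij_betw (orth L) (ornament_rels V L) (ornament_rels V (L\<inverse>))"
proof -
  interpret op: chain_intervals V "L\<inverse>" by (rule dual)
  show ?thesis
    using orth_in_ornament_rels op.orth_in_ornament_rels orth_orth op.orth_orth
    by (intro bij_betw_byWitness[where f' = "orth (L\<inverse>)"]) auto
qed

lemma orth_subset_iff:
  assumes "R \<in> ornament_rels V L" "R' \<in> ornament_rels V L"
  shows "orth L R' \<subseteq> orth L R \<longleftrightarrow> R \<subseteq> R'"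
  using assms orth_orth orth_antimono by metis

end

section \<open>Directed walks in a directed tree\<close>

fun nonbacktracking :: "'a list \<Rightarrow> bool" where
  "nonbacktracking (x # y # z # zs) \<longleftrightarrow> x \<noteq> z \<and> nonbacktracking (y # z # zs)"
| "nonbacktracking _ \<longleftrightarrow> True"

lemma nonbacktracking_tl: "nonbacktracking (x # xs) \<Longrightarrow> nonbacktracking xs"
  by (induction "x # xs" rule: nonbacktracking.induct) auto

lemma nonbacktracking_append:
  assumes "nonbacktracking (xs @ [a, u])" "nonbacktracking (u # b # ys)" "a \<noteq> b"
  shows "nonbacktracking (xs @ a # u # b # ys)"
  using assms
proof (induction xs)
  case (Cons x xs)
  then show ?case
    by (cases xs rule: nonbacktracking.cases) auto
qed simp

lemma successively_asym_imp_nonbacktracking: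
  assumes "asym R" "successively (\<lambda>x y. (x, y) \<in> R) p"
  shows "nonbacktracking p"
  using assms(2)
  by (induction p rule: nonbacktracking.induct) (use assms(1) in \<open>auto dest: asymD\<close>)

lemma set_vwalk_arcs_subset_iff:
  "set (vwalk_arcs p) \<subseteq> A \<longleftrightarrow> successively (\<lambda>x y. (x, y) \<in> A) p"
  by (induction p rule: vwalk_arcs.induct) auto

lemma vwalk_iff_successively:
  "vwalk p (with_proj D) \<longleftrightarrow>
     set p \<subseteq> pverts D \<and> successively (\<lambda>x y. (x, y) \<in> parcs D) p \<and> p \<noteq> []"
  by (simp add: vwalk_def set_vwalk_arcs_subset_iff)

lemma pcas_vwalk_arcs: "p \<noteq> [] \<Longrightarrow> pcas (hd p) (vwalk_arcs p) (last p)"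
  by (induction p rule: vwalk_arcs.induct) auto

lemma pawalk_verts_vwalk_arcs: "p \<noteq> [] \<Longrightarrow> pawalk_verts (hd p) (vwalk_arcs p) = p"
  by (induction p rule: vwalk_arcs.induct) auto

text \<open>
  A walk in a forest that never turns straight back cannot return to a vertex. At a first return, read
  from the end of the walk, the vertices in between are distinct and form a closed walk; it has at least
  three edges, because one edge would be a loop and two edges a backtrack, so it is a cycle.
\<close>

lemma nonbacktracking_walk_distinct:
  assumes D: "directed_tree D"
    and "successively (\<lambda>x y. (x, y) \<in> parcs D \<union> (parcs D)\<inverse>) p" and "nonbacktracking p"
  shows "distinct p"
  using assms(2,3)
proof (induction p)
  case (Cons x p)
  have "successively (\<lambda>x y. (x, y) \<in> parcs D \<union> (parcs D)\<inverse>) p"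
    using Cons.prems(1) by (cases p) auto
  then have dist: "distinct p"
    using Cons.IH nonbacktracking_tl[OF Cons.prems(2)] by simp
  have "x \<notin> set p"
  proof
    assume "x \<in> set p"
    then obtain ys zs where p: "p = ys @ x # zs" by (meson split_list)
    let ?S = "mk_symmetric (with_proj D)" and ?c = "x # ys @ [x]"
    interpret D: pair_wf_digraph D using D by (simp add: directed_tree_def)
    have parcs_S: "parcs ?S = parcs D \<union> (parcs D)\<inverse>"
      by (auto simp: parcs_mk_symmetric)
    interpret S: pair_wf_digraph ?S by (rule D.wellformed_mk_symmetric)
    have "successively (\<lambda>x y. (x, y) \<in> parcs ?S) (?c @ zs)"
      using Cons.prems(1) by (simp add: parcs_S p)
    then have succ: "successively (\<lambda>x y. (x, y) \<in> parcs ?S) ?c"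
      unfolding successively_append_iff by blast
    have "asym (parcs D)" using D by (simp add: directed_tree_def)
    then have loopfree: "(x, x) \<notin> parcs ?S" unfolding parcs_S by (auto dest: asymD)
    have "ys \<noteq> []" using succ loopfree by auto
    moreover have "ys \<noteq> [y]" for y using Cons.prems(2) p by auto
    ultimately have "2 \<le> length ys"
      by (cases ys rule: nonbacktracking.cases) auto
    then have len: "3 \<le> length (vwalk_arcs ?c)"
      using vwalk_length_simp[of ?c] unfolding vwalk_length_def by simp
    have "x \<in> pverts ?S"
      using succ S.in_arcsD1 by (cases ys) (auto simp del: pverts_mk_symmetric)
    moreover have "set (vwalk_arcs ?c) \<subseteq> parcs ?S"
      using succ by (simp only: set_vwalk_arcs_subset_iff)
    ultimately have "S.awalk x (vwalk_arcs ?c) x"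
      using pcas_vwalk_arcs[of ?c] by (simp add: S.awalk_def)
    moreover have "distinct (tl (pawalk_verts x (vwalk_arcs ?c)))"
      using dist pawalk_verts_vwalk_arcs[of ?c] by (simp add: p)
    ultimately have "S.cycle (vwalk_arcs ?c)"
      using len by (auto simp: S.cycle_def)
    then show False using D len unfolding directed_tree_def by blast
  qed
  with dist show ?case by simp
qed simp

lemma directed_walk_distinct:
  assumes D: "directed_tree D" and p: "vwalk p (with_proj D)"
  shows "distinct p"
proof (rule nonbacktracking_walk_distinct[OF D])
  have *: "successively (\<lambda>x y. (x, y) \<in> parcs D) p"
    using p by (simp add: vwalk_iff_successively)
  then show "successively (\<lambda>x y. (x, y) \<in> parcs D \<union> (parcs D)\<inverse>) p"
    by (rule successively_mono) simp
  show "nonbacktracking p"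
    using * D by (intro successively_asym_imp_nonbacktracking) (auto simp: directed_tree_def)
qed

text \<open>
  Compare the last edges. If they agree, they can be removed. If they differ, following \<open>p\<close> and then
  \<open>q\<close> backwards never backtracks: inside \<open>p\<close> and \<open>q\<close> a backtrack would need two opposite arcs, and
  at the turning point the two edges are different. But this walk returns to its start.
\<close>

lemma directed_walk_unique:
  assumes D: "directed_tree D"
    and "vwalk p (with_proj D)" "vwalk q (with_proj D)" "hd p = hd q" "last p = last q"
  shows "p = q"
  using assms(2-)
proof (induction p arbitrary: q rule: rev_induct)
  case Nil
  then show ?case by auto
next
  case (snoc u p)
  have q_ne: "q \<noteq> []" using snoc.prems by (auto simp: vwalk_def)
  then obtain q' where q: "q = q' @ [u]"
    using snoc.prems(4) by (metis append_butlast_last_id last_snoc)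
  have dist: "distinct (p @ [u])" "distinct (q' @ [u])"
    using snoc.prems(1,2) directed_walk_distinct[OF D] unfolding q by blast+
  consider "p = []" | "q' = []" | "p \<noteq> []" "q' \<noteq> []" by blast
  then show ?case
  proof cases
    case 1
    then show ?thesis using snoc.prems(3) q dist by (cases q') auto
  next
    case 2
    then show ?thesis using snoc.prems(3) q dist by (cases p) auto
  next
    case 3
    then obtain p1 a q1 b where pq: "p = p1 @ [a]" "q' = q1 @ [b]"
      by (metis append_butlast_last_id)
    show ?thesis
    proof (cases "a = b")
      case True
      have "p = q'"
        using snoc.prems True 3 pq q
        by (intro snoc.IH) (auto simp: vwalk_iff_successively successively_append_iff hd_append split: if_splits)
      then show ?thesis using q by simp
    next
      case False
      let ?c = "p1 @ a # u # b # rev q1"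
      have asym: "asym (parcs D)" using D by (simp add: directed_tree_def)
      have sp: "successively (\<lambda>x y. (x, y) \<in> parcs D) (p1 @ [a, u])"
        and sq: "successively (\<lambda>x y. (x, y) \<in> (parcs D)\<inverse>) (rev (q1 @ [b, u]))"
        using snoc.prems pq q by (simp_all add: vwalk_iff_successively del: rev_append)
      have "nonbacktracking (p1 @ [a, u])"
        using sp asym by (rule successively_asym_imp_nonbacktracking[rotated])
      moreover have "nonbacktracking (u # b # rev q1)"
        using successively_asym_imp_nonbacktracking[OF _ sq] asym by simp
      ultimately have "nonbacktracking ?c"
        using False by (rule nonbacktracking_append)
      moreover have "successively (\<lambda>x y. (x, y) \<in> parcs D \<union> (parcs D)\<inverse>) ?c"
        using successively_mono[OF sp, of "\<lambda>x y. (x, y) \<in> parcs D \<union> (parcs D)\<inverse>"]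
          successively_mono[OF sq, of "\<lambda>x y. (x, y) \<in> parcs D \<union> (parcs D)\<inverse>"]
        by (auto simp: successively_append_iff)
      ultimately have "distinct ?c"
        using nonbacktracking_walk_distinct[OF D] by blast
      moreover have "hd (p1 @ [a]) = hd (q1 @ [b])"
        using snoc.prems(3) pq q by (simp add: hd_append split: if_splits)
      then have "\<not> distinct ?c"
        by (cases p1; cases q1) auto
      ultimately show ?thesis by blast
    qed
  qed
qed

section \<open>The reachability order of a directed tree\<close>

definition reachability :: "'a pair_pre_digraph \<Rightarrow> 'a rel" where
  "reachability D = {(u, v). u \<rightarrow>\<^sup>*\<^bsub>with_proj D\<^esub> v}"

lemma reachability_iff_vwalk:
  assumes "directed_tree D"
  shows "(u, v) \<in> reachability D \<longleftrightarrow> (\<exists>p. vwalk p (with_proj D) \<and> hd p = u \<and> last p = v)"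
proof -
  interpret pair_wf_digraph D using assms by (simp add: directed_tree_def)
  show ?thesis by (simp add: reachability_def reachable_vwalk_conv)
qed

lemma reachability_refl: "v \<in> pverts D \<Longrightarrow> (v, v) \<in> reachability D"
  by (simp add: reachability_def reachable_def)

lemma reachability_trans: "trans (reachability D)"
  unfolding reachability_def by (auto intro!: transI simp: reachable_def intro: rtrancl_on_trans)

lemma reachability_within: "reachability D \<subseteq> pverts D \<times> pverts D"
  by (auto simp: reachability_def reachable_def dest: in_rtrancl_on_in_F)

text \<open>
  A vertex \<open>w\<close> between the endpoints lies on a walk that is composed of one to \<open>w\<close> and one from \<open>w\<close>,
  and by uniqueness this is the given walk. Antisymmetry of reachability (take the
  one-vertex walk), the chain condition and finiteness of intervals are read off from this.
\<close>

lemma set_vwalk_eq_interval: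
  assumes D: "directed_tree D" and p: "vwalk p (with_proj D)"
  shows "set p = {w. (hd p, w) \<in> reachability D \<and> (w, last p) \<in> reachability D}"
proof (intro equalityI subsetI)
  fix w
  assume "w \<in> set p"
  then obtain ys zs where ps: "p = (ys @ [w]) @ zs" and ps': "p = ys @ w # zs"
    by (metis append.assoc append_Cons append_Nil split_list)
  have "vwalk (ys @ [w]) (with_proj D)" "vwalk (w # zs) (with_proj D)"
    using p unfolding ps' by (auto simp: vwalk_iff_successively successively_append_iff)
  moreover have "hd (ys @ [w]) = hd p" "last (w # zs) = last p"
    unfolding ps' by (auto simp: hd_append)
  ultimately show "w \<in> {w. (hd p, w) \<in> reachability D \<and> (w, last p) \<in> reachability D}"
    unfolding reachability_iff_vwalk[OF D] by (metis (mono_tags, lifting) last_snoc list.sel(1) mem_Collect_eq)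
next
  fix w
  assume "w \<in> {w. (hd p, w) \<in> reachability D \<and> (w, last p) \<in> reachability D}"
  then obtain q r where q: "vwalk q (with_proj D)" "hd q = hd p" "last q = w"
    and r: "vwalk r (with_proj D)" "hd r = w" "last r = last p"
    unfolding mem_Collect_eq reachability_iff_vwalk[OF D] by blast
  have j: "joinable q r" using q r by (auto simp: joinable_def vwalk_def)
  have "vwalk (vwalk_join q r) (with_proj D)"
    using q r j by (intro vwalk_joinI_vwalk)
  then have "p = vwalk_join q r"
    using directed_walk_unique[OF D p] q r j by (simp add: vwalk_join_hd vwalk_join_last)
  moreover have "w \<in> set q" using q by (auto simp: vwalk_def)
  ultimately show "w \<in> set p" by (auto simp: vwalk_join_def)
qed

lemma chain_intervals_reachability:
  assumes D: "directed_tree D"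
  shows "chain_intervals (pverts D) (reachability D)"
proof
  show "antisym (reachability D)"
  proof (rule antisymI)
    fix u v
    assume uv: "(u, v) \<in> reachability D" "(v, u) \<in> reachability D"
    then have "vwalk [u] (with_proj D)" using reachability_within by fastforce
    from set_vwalk_eq_interval[OF D this] uv show "u = v" by auto
  qed
next
  fix v u w w'
  assume w: "(v, w) \<in> reachability D" "(w, u) \<in> reachability D"
    and w': "(v, w') \<in> reachability D" "(w', u) \<in> reachability D"
  from w(1) obtain q where q: "vwalk q (with_proj D)" "hd q = v" "last q = w"
    unfolding reachability_iff_vwalk[OF D] by blast
  from w(2) obtain r where r: "vwalk r (with_proj D)" "hd r = w" "last r = u"
    unfolding reachability_iff_vwalk[OF D] by blast
  have j: "joinable q r" using q r by (auto simp: joinable_def vwalk_def)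
  have walk: "vwalk (vwalk_join q r) (with_proj D)"
    using q r j by (intro vwalk_joinI_vwalk)
  \<comment> \<open>Both points lie on the walk from \<open>v\<close> to \<open>u\<close> through \<open>w\<close>, before or after \<open>w\<close>.\<close>
  have "w' \<in> set (vwalk_join q r)"
    unfolding set_vwalk_eq_interval[OF D walk] using w' q r j
    by (simp add: vwalk_join_hd vwalk_join_last)
  then have "w' \<in> set q \<or> w' \<in> set r"
    by (cases r) (auto simp: vwalk_join_def)
  then show "(w, w') \<in> reachability D \<or> (w', w) \<in> reachability D"
    using set_vwalk_eq_interval[OF D q(1)] set_vwalk_eq_interval[OF D r(1)] q r by auto
next
  fix v u
  show "finite {w. (v, w) \<in> reachability D \<and> (w, u) \<in> reachability D}"
  proof (cases "(v, u) \<in> reachability D")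
    case True
    then obtain p where "vwalk p (with_proj D)" "hd p = v" "last p = u"
      unfolding reachability_iff_vwalk[OF D] by blast
    then show ?thesis using set_vwalk_eq_interval[OF D] by (metis finite_set)
  next
    case False
    then have "{w. (v, w) \<in> reachability D \<and> (w, u) \<in> reachability D} = {}"
      using transD[OF reachability_trans[of D]] by blast
    then show ?thesis by (simp only: finite.emptyI)
  qed
qed (use reachability_within reachability_refl reachability_trans in auto)

lemma v_connected_iff_intervals:
  assumes D: "directed_tree D"
  shows "v_connected D v S \<longleftrightarrow> v \<in> S \<and> (\<forall>u\<in>S. (v, u) \<in> reachability D \<and>
           (\<forall>w. (v, w) \<in> reachability D \<longrightarrow> (w, u) \<in> reachability D \<longrightarrow> w \<in> S))"
    (is "_ \<longleftrightarrow> v \<in> S \<and> (\<forall>u\<in>S. ?closed u)")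
proof -
  have path: "(\<exists>p. vpath p (with_proj D) \<and> hd p = v \<and> last p = u \<and> set p \<subseteq> S) \<longleftrightarrow> ?closed u"
    for u
  proof
    assume "\<exists>p. vpath p (with_proj D) \<and> hd p = v \<and> last p = u \<and> set p \<subseteq> S"
    then obtain p where "vwalk p (with_proj D)" "hd p = v" "last p = u" "set p \<subseteq> S"
      by blast
    then show "?closed u"
      using set_vwalk_eq_interval[OF D] reachability_iff_vwalk[OF D] by blast
  next
    assume *: "?closed u"
    then obtain p where "vwalk p (with_proj D)" "hd p = v" "last p = u"
      using reachability_iff_vwalk[OF D] by blast
    then show "\<exists>p. vpath p (with_proj D) \<and> hd p = v \<and> last p = u \<and> set p \<subseteq> S"
      using * set_vwalk_eq_interval[OF D, of p] directed_walk_distinct[OF D] by blast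
  qed
  show ?thesis
    unfolding v_connected_def path using reachability_within by blast
qed

text \<open>
  The underlying undirected graph, on which connectedness and cycles depend, does not change.
\<close>

lemma directed_tree_op:
  assumes "directed_tree D"
  shows "directed_tree (op_digraph D)"
proof -
  have "mk_symmetric (with_proj (op_digraph D)) = mk_symmetric (with_proj D)"
    by (auto simp: mk_symmetric_def op_digraph_def)
  moreover have "pair_wf_digraph (op_digraph D)"
    using assms by (auto simp: directed_tree_def op_digraph_def pair_wf_digraph_def)
  ultimately show ?thesis
    using assms by (simp add: directed_tree_def connected_def) (simp add: op_digraph_def)
qed

lemma reachability_op: 
  assumes D: "directed_tree D"
  shows "reachability (op_digraph D) = (reachability D)\<inverse>"
proof -
  have rev: "vwalk (rev p) (with_proj (op_digraph D)) \<longleftrightarrow> vwalk p (with_proj D)" for p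
    by (simp add: vwalk_iff_successively op_digraph_def)
  have "(u, v) \<in> reachability (op_digraph D) \<longleftrightarrow> (v, u) \<in> reachability D" for u v
    unfolding reachability_iff_vwalk[OF D] reachability_iff_vwalk[OF directed_tree_op[OF D]]
    by (metis rev last_rev rev_rev_ident)
  then show ?thesis by auto
qed

section \<open>Ornamentations as relations\<close>

definition ornament_rel :: "'a set \<Rightarrow> ('a \<Rightarrow> 'a set \<times> 'a) \<Rightarrow> 'a rel" where
  "ornament_rel V \<rho> = Sigma V (\<lambda>v. fst (\<rho> v))"

lemma ornament_rel_subset_iff:
  "ornament_rel V \<rho> \<subseteq> ornament_rel V \<rho>' \<longleftrightarrow> (\<forall>v\<in>V. fst (\<rho> v) \<subseteq> fst (\<rho>' v))"
  by (auto simp: ornament_rel_def)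

text \<open>
  Connectedness of the sets \<open>\<rho>(v)\<close> is closure under initial parts of intervals, and the nesting
  condition is transitivity.
\<close>

lemma bij_betw_ornament_rel:
  assumes D: "directed_tree D"
  defines "V \<equiv> pverts D"
  shows "bij_betw (ornament_rel V) (ornamentations V (building_set D))
           (ornament_rels V (reachability D))"
proof (rule bij_betw_byWitness[where f' = "\<lambda>R. \<lambda>v\<in>V. (R `` {v}, v)"])
  have within: "reachability D \<subseteq> V \<times> V"
    using reachability_within V_def by simp
  note connected_iff = v_connected_iff_intervals[OF D]
  show "\<forall>\<rho>\<in>ornamentations V (building_set D).
          (\<lambda>v\<in>V. (ornament_rel V \<rho> `` {v}, v)) = \<rho>"
  proof (intro ballI ext)
    fix \<rho> v
    assume "\<rho> \<in> ornamentations V (building_set D)"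
    then show "(\<lambda>v\<in>V. (ornament_rel V \<rho> `` {v}, v)) v = \<rho> v"
      by (auto simp: ornamentations_def ornament_rel_def restrict_def PiE_def extensional_def
          intro!: prod_eqI)
  qed
  show "\<forall>R\<in>ornament_rels V (reachability D). ornament_rel V (\<lambda>v\<in>V. (R `` {v}, v)) = R"
    using within by (auto simp: ornament_rels_def ornament_rel_def)
  show "ornament_rel V ` ornamentations V (building_set D) \<subseteq> ornament_rels V (reachability D)"
  proof (intro image_subsetI)
    fix \<rho>
    assume \<rho>: "\<rho> \<in> ornamentations V (building_set D)"
    have conn: "v_connected D v (fst (\<rho> v))" if "v \<in> V" for v
    proof -
      have "\<rho> v \<in> building_set D" "snd (\<rho> v) = v"
        using \<rho> that by (auto simp: ornamentations_def)
      then show ?thesis by (auto simp: building_set_def)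
    qed
    have nested: "fst (\<rho> u) \<subseteq> fst (\<rho> v)" if "v \<in> V" "u \<in> fst (\<rho> v)" for u v
      using \<rho> that by (auto simp: ornamentations_def)
    show "ornament_rel V \<rho> \<in> ornament_rels V (reachability D)"
      unfolding ornament_rels_def mem_Collect_eq
    proof (intro conjI)
      show "trans (ornament_rel V \<rho>)"
        using nested by (intro transI) (auto simp: ornament_rel_def)
    qed (use conn connected_iff in \<open>auto simp: ornament_rel_def\<close>)
  qed
  show "(\<lambda>R. \<lambda>v\<in>V. (R `` {v}, v)) ` ornament_rels V (reachability D)
          \<subseteq> ornamentations V (building_set D)"
  proof (intro image_subsetI)
    fix R
    assume R: "R \<in> ornament_rels V (reachability D)"
    have "v_connected D v (R `` {v})" if "v \<in> V" for v
      unfolding connected_iff using R that by (fastforce simp: ornament_rels_def)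
    moreover have "R \<subseteq> V \<times> V" "trans R" using R within by (auto simp: ornament_rels_def)
    ultimately show "(\<lambda>v\<in>V. (R `` {v}, v)) \<in> ornamentations V (building_set D)"
      by (auto simp: ornamentations_def building_set_def dest: transD)
  qed
qed

theorem theorem5p3:
  fixes D :: "'a pair_pre_digraph"
  assumes "directed_tree D"
  shows "\<exists>f. poset_iso (digraph_ornamentation_poset (op_digraph D))
                       (inv_gorder (digraph_ornamentation_poset D)) f"
proof -
  let ?V = "pverts D" and ?L = "reachability D"
  let ?O = "ornamentations ?V (building_set D)"
  let ?O' = "ornamentations ?V (building_set (op_digraph D))"
  let ?r = "ornament_rel ?V"
  \<comment> \<open>The orthogonality map starts from relations of the opposite tree, hence the converse order.\<close>
  interpret chain_intervals ?V "?L\<inverse>"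
    using chain_intervals_reachability[OF assms] by (rule chain_intervals.dual)
  have verts_op: "pverts (op_digraph D) = ?V" by (simp add: op_digraph_def)
  have bij: "bij_betw ?r ?O (ornament_rels ?V ?L)"
    using assms by (rule bij_betw_ornament_rel)
  have bij_op: "bij_betw ?r ?O' (ornament_rels ?V (?L\<inverse>))"
    using bij_betw_ornament_rel[OF directed_tree_op[OF assms]]
    by (simp add: verts_op reachability_op[OF assms])
  define f where "f = inv_into ?O ?r \<circ> (orth (?L\<inverse>) \<circ> ?r)"
  have bij_f: "bij_betw f ?O' ?O"
    unfolding f_def using bij_op bij_betw_orth bij_betw_inv_into[OF bij]
    by (auto intro: bij_betw_trans)
  have r_f: "?r (f \<rho>) = orth (?L\<inverse>) (?r \<rho>)" if "\<rho> \<in> ?O'" for \<rho>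
  proof -
    have "orth (?L\<inverse>) (?r \<rho>) \<in> ornament_rels ?V ?L"
      using that bij_op bij_betw_orth by (auto dest: bij_betwE)
    then show ?thesis
      using bij_betw_inv_into_right[OF bij] by (simp add: f_def)
  qed
  have anti: "?r (f \<rho>') \<subseteq> ?r (f \<rho>) \<longleftrightarrow> ?r \<rho> \<subseteq> ?r \<rho>'" if "\<rho> \<in> ?O'" "\<rho>' \<in> ?O'" for \<rho> \<rho>'
    using that bij_op by (simp add: r_f bij_betwE orth_subset_iff)
  have carriers: "carrier (digraph_ornamentation_poset (op_digraph D)) = ?O'"
      "carrier (inv_gorder (digraph_ornamentation_poset D)) = ?O"
    by (simp_all add: digraph_ornamentation_poset_def ornamentation_poset_def verts_op)
  have po: "weak_partial_order (digraph_ornamentation_poset E)" for E :: "'a pair_pre_digraph"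
    unfolding digraph_ornamentation_poset_def
    using partial_order_ornamentation_poset by (rule partial_order.axioms)
  have "poset_iso (digraph_ornamentation_poset (op_digraph D))
          (inv_gorder (digraph_ornamentation_poset D)) f"
    unfolding poset_iso_def order_emb_def carriers
  proof (intro conjI ballI)
    show "weak_partial_order (inv_gorder (digraph_ornamentation_poset D))"
      using po by (rule weak_partial_order.dual_weak_order)
  next
    fix \<rho> \<rho>'
    assume "\<rho> \<in> ?O'" "\<rho>' \<in> ?O'"
    then show "f \<rho> \<sqsubseteq>\<^bsub>inv_gorder (digraph_ornamentation_poset D)\<^esub> f \<rho>' \<longleftrightarrow>
                 \<rho> \<sqsubseteq>\<^bsub>digraph_ornamentation_poset (op_digraph D)\<^esub> \<rho>'"
      using anti
      by (simp add: ornament_rel_subset_iff digraph_ornamentation_poset_def ornamentation_poset_def verts_op)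
  qed (use bij_f po in auto)
  then show ?thesis by blast
qed

end
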